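(* Let $\{\mathcal{X}, \mathtt{d}\}$ be a compact metric space with $\mathtt{d}$ as the metric function, let $p$ be a Borel probability measure on $\mathcal{X}$, and let $X$ be a random variable on $\mathcal{X}$ with distribution function $F_X(x)$. If $F_X(x)$ is absolutely continuous and the density function $f_X$ is square-integrable, i.e. $f_X\in L^2$, then there exists a unique element $\mu_p\in\mathcal{H}$ (unique as a family of functions that are equal almost everywhere) such that $$\mathbb{E}_X[g(x)] = \langle \mu_p, g\rangle_{\mathcal{H}}\qquad\text{for all } g\in\mathcal{H},$$ where $\mu_p$ denotes the embedding of the probability measure $p$ in the Hilbert space $\mathcal{H}=(L^2,\langle\cdot,\cdot\rangle)$, with the inner product given by $$\langle g,h\rangle_{\mathcal{H}} := \int_x g(x)h(x)\,\rho(dx).$$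
   Context: Random variables take values in $\mathbb{R}^d$ ($d\in\mathbb{N}$), and $X$ is distributed according to $p$. $L^2=L^2(\mathcal{X},\rho)$ denotes the space of (real-valued) square-integrable functions on $\mathcal{X}$, where $\rho$ is a Lebesgue measure. $F_X$ absolutely continuous means $F_X(x)=\int_{-\infty}^x f_X(t)\,dt$, where $f_X$ is the probability density function of $X$. $\mathbb{E}_X[g(x)]=\int g(x)\,dF_X(x)$ is the expectation of $g$ under the distribution of $X$. *)

theory Defs
  imports "HOL-Probability.Probability"
begin

text \<open>
  Joint distribution function of a random vector. The order on \<^typ>\<open>real ^ 'd\<close> is
  componentwise, so \<^term>\<open>{..x}\<close> is the orthant usually written \<open>(-\<infinity>, x]\<close>.
\<close>

definition joint_cdf :: "'w measure \<Rightarrow> ('w \<Rightarrow> real ^ 'd) \<Rightarrow> real ^ 'd \<Rightarrow> real" where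
  "joint_cdf M X x = measure M {\<omega> \<in> space M. X \<omega> \<le> x}"

definition absolutely_continuous_with_density ::
    "(real ^ 'd \<Rightarrow> real) \<Rightarrow> (real ^ 'd \<Rightarrow> real) \<Rightarrow> bool" where
  "absolutely_continuous_with_density F f \<longleftrightarrow>
     f \<in> borel_measurable borel \<and> (\<forall>t. 0 \<le> f t) \<and>
     (\<forall>x. set_integrable lborel {..x} f \<and> F x = (LINT t:{..x}|lborel. f t))"

definition square_integrable :: "'a measure \<Rightarrow> ('a \<Rightarrow> real) set" where
  "square_integrable M = {f \<in> borel_measurable M. integrable M (\<lambda>x. (f x)\<^sup>2)}"

definition ae_eq :: "'a measure \<Rightarrow> (('a \<Rightarrow> real) \<times> ('a \<Rightarrow> real)) set" where
  "ae_eq M = {(f, g). f \<in> square_integrable M \<and> g \<in> square_integrable M \<and>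
                      (AE x in M. f x = g x)}"

text \<open>
  Elements of \<open>L2 M\<close> are classes of functions on the whole type, but membership in a class
  depends only on the values on \<^term>\<open>space M\<close>.
\<close>

definition L2 :: "'a measure \<Rightarrow> ('a \<Rightarrow> real) set set" where
  "L2 M = square_integrable M // ae_eq M"

text \<open>
  The inner product of two classes is computed on representatives; \<open>L2_inner_eq\<close> below shows
  that their choice is irrelevant.
\<close>

definition L2_inner :: "'a measure \<Rightarrow> ('a \<Rightarrow> real) set \<Rightarrow> ('a \<Rightarrow> real) set \<Rightarrow> real" where
  "L2_inner M A B = (\<integral>x. (SOME g. g \<in> A) x * (SOME h. h \<in> B) x \<partial>M)"

lemma equiv_ae_eq: "equiv (square_integrable M) (ae_eq M)"
proof (rule equivI)
  show "ae_eq M \<subseteq> square_integrable M \<times> square_integrable M"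
    by (auto simp: ae_eq_def)
  show "refl_on (square_integrable M) (ae_eq M)"
    by (auto simp: refl_on_def ae_eq_def)
  show "sym (ae_eq M)"
    by (auto simp: sym_def ae_eq_def eq_commute)
  show "trans (ae_eq M)"
    by (auto simp: trans_def ae_eq_def)
qed

lemma L2_inner_eq:
  assumes "A \<in> L2 M" "B \<in> L2 M" "g \<in> A" "h \<in> B"
  shows "L2_inner M A B = (\<integral>x. g x * h x \<partial>M)"
proof -
  define g' where "g' = (SOME g. g \<in> A)"
  define h' where "h' = (SOME h. h \<in> B)"
  have "g' \<in> A" "h' \<in> B"
    unfolding g'_def h'_def using someI[of "\<lambda>g. g \<in> A" g] someI[of "\<lambda>h. h \<in> B" h] assms(3,4)
    by simp_all
  then have "(g', g) \<in> ae_eq M" "(h', h) \<in> ae_eq M"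
    using assms quotient_eq_iff[OF equiv_ae_eq] unfolding L2_def by blast+
  then have [measurable]: "g \<in> borel_measurable M" "g' \<in> borel_measurable M"
      "h \<in> borel_measurable M" "h' \<in> borel_measurable M"
    and ae: "AE x in M. g' x = g x" "AE x in M. h' x = h x"
    by (auto simp: ae_eq_def square_integrable_def)
  have "(\<integral>x. g' x * h' x \<partial>M) = (\<integral>x. g x * h x \<partial>M)"
    by (rule integral_cong_AE) (use ae in auto)
  then show ?thesis
    by (simp add: L2_inner_def g'_def h'_def)
qed

end

theory Submission
  imports Defs
begin

text \<open>
  Lower orthants form an intersection-stable generator of the Borel sets, so the distribution
  function determines the law of \<open>X\<close>, and \<open>p\<close> has density \<open>f\<close> with respect to \<open>\<rho>\<close>. Hence
  integrating \<open>g\<close> against \<open>p\<close> is integrating \<open>f g\<close> against \<open>\<rho>\<close>, and the class of \<open>f\<close> is the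
  embedding. It is unique because the difference of two candidates is orthogonal to itself.
\<close>

text \<open>Finiteness is asked on orthants only: countably many of them exhaust the space, which is
  what uniqueness on an intersection-stable generator requires. The meet of two orthants has the
  componentwise minimum of their corners as its corner.\<close>

lemma borel_measure_eqI_atMost:
  fixes \<mu> \<nu> :: "'a::ordered_euclidean_space measure"
  assumes sets: "sets \<mu> = sets borel" "sets \<nu> = sets borel"
    and eq: "\<And>x. emeasure \<mu> {..x} = emeasure \<nu> {..x}"
    and fin: "\<And>x. emeasure \<mu> {..x} \<noteq> \<infinity>"
  shows "\<mu> = \<nu>"
proof (rule measure_eqI_generator_eq)
  show "Int_stable (range (\<lambda>a::'a. {..a}))"
  proof (rule Int_stableI_image)
    show "\<exists>c\<in>UNIV. {..a} \<inter> {..b} = {..c}" for a b :: 'a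
      by (rule bexI[of _ "inf a b"]) auto
  qed
  \<comment> \<open>Corners on the diagonal suffice, since every coordinate of \<open>x\<close> is
    at most \<open>norm x\<close>.\<close>
  show "(\<Union>n. {..real n *\<^sub>R (One::'a)}) = UNIV"
  proof (intro equalityI subsetI UNIV_I)
    fix x :: 'a
    obtain n :: nat where n: "norm x < real n"
      using reals_Archimedean2 by blast
    have "x \<bullet> i \<le> real n" if "i \<in> Basis" for i
      using n Basis_le_norm[OF that, of x] by linarith
    then have "x \<in> {..real n *\<^sub>R One}"
      by (auto simp: eucl_le[of x])
    then show "x \<in> (\<Union>n. {..real n *\<^sub>R (One::'a)})"
      by blast
  qed
qed (use assms in \<open>auto simp: borel_eq_atMost\<close>)

lemma distr_eq_density_of_joint_cdf:
  fixes X :: "'w \<Rightarrow> real ^ 'd"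
  assumes "prob_space M" and [measurable]: "X \<in> borel_measurable M"
    and f: "absolutely_continuous_with_density (joint_cdf M X) f"
  shows "distr M borel X = density lborel f"
proof (rule borel_measure_eqI_atMost)
  interpret prob_space M by fact
  have [measurable]: "f \<in> borel_measurable borel"
    and nonneg: "\<And>t. 0 \<le> f t"
    and int: "\<And>x. set_integrable lborel {..x} f"
    and cdf: "\<And>x. joint_cdf M X x = (LINT t:{..x}|lborel. f t)"
    using f by (auto simp: absolutely_continuous_with_density_def)
  fix x
  have "emeasure (distr M borel X) {..x} = emeasure M (X -` {..x} \<inter> space M)"
    by (simp add: emeasure_distr)
  also have "X -` {..x} \<inter> space M = {\<omega> \<in> space M. X \<omega> \<le> x}"
    by auto
  also have "emeasure M \<dots> = ennreal (LINT t:{..x}|lborel. f t)"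
    by (simp add: emeasure_eq_measure flip: cdf joint_cdf_def)
  \<comment> \<open>Integrability on the orthant matters here: a Bochner integral that fails to
    exist is 0 by default and would not match the nonnegative integral.\<close>
  also have "\<dots> = (\<integral>\<^sup>+ t. ennreal (indicator {..x} t * f t) \<partial>lborel)"
    using int nonneg unfolding set_lebesgue_integral_def set_integrable_def
    by (subst nn_integral_eq_integral) auto
  also have "\<dots> = emeasure (density lborel f) {..x}"
    by (auto simp: emeasure_density indicator_def intro!: nn_integral_cong)
  finally show "emeasure (distr M borel X) {..x} = emeasure (density lborel f) {..x}" .
  show "emeasure (distr M borel X) {..x} \<noteq> \<infinity>"
    by (simp add: emeasure_distr)
qed auto

text \<open>The distribution function fixes the law on the whole space, whereas \<open>p\<close>
  lives on \<open>S\<close>. Measurable subsets of a measurable \<open>S\<close> are measurable in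
  the whole space, so the identity can be tested there. \<open>N\<close> carries the reference
  measure, \<open>B\<close> only the sigma-algebra.\<close>

lemma distr_restrict_space_eq_density:
  assumes S: "S \<in> sets N" and N: "sets N = sets B"
    and X: "X \<in> M \<rightarrow>\<^sub>M restrict_space B S"
    and f[measurable]: "f \<in> borel_measurable N"
    and eq: "distr M B X = density N f"
  shows "distr M (restrict_space B S) X = density (restrict_space N S) f"
proof (rule measure_eqI)
  show "sets (distr M (restrict_space B S) X) = sets (density (restrict_space N S) f)"
    using N by (simp cong: sets_restrict_space_cong)
  fix A assume "A \<in> sets (distr M (restrict_space B S) X)"
  then have A: "A \<in> sets (restrict_space B S)" by simp
  then have A': "A \<subseteq> S" "A \<in> sets N"
    using S N by (auto simp: sets_restrict_space)
  have XB: "X \<in> M \<rightarrow>\<^sub>M B"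
    using X by (simp add: measurable_restrict_space2_iff)
  have "emeasure (distr M (restrict_space B S) X) A = emeasure (distr M B X) A"
    using A A' X XB N by (simp add: emeasure_distr)
  also have "\<dots> = (\<integral>\<^sup>+ x. f x * indicator A x \<partial>N)"
    using A' by (simp add: eq emeasure_density)
  \<comment> \<open>The factor \<open>indicator S\<close> changes nothing on \<open>A\<close> and
    gives the integrand the shape of an integral over the restricted space.\<close>
  also have "\<dots> = (\<integral>\<^sup>+ x. f x * indicator A x * indicator S x \<partial>N)"
    using A'(1) by (intro nn_integral_cong) (auto simp: indicator_def)
  also have "\<dots> = (\<integral>\<^sup>+ x. f x * indicator A x \<partial>restrict_space N S)"
    using S by (subst nn_integral_restrict_space) auto
  also have "\<dots> = emeasure (density (restrict_space N S) f) A"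
    using A N by (subst emeasure_density)
      (auto intro: measurable_restrict_space1 cong: sets_restrict_space_cong)
  finally show "emeasure (distr M (restrict_space B S) X) A
    = emeasure (density (restrict_space N S) f) A" .
qed

text \<open>The pointwise bound \<bar>a b\<bar> \<le> a^2 + b^2 takes the place of the
  Cauchy-Schwarz inequality.\<close>

lemma integrable_mult_square_integrable:
  assumes "f \<in> square_integrable M" "g \<in> square_integrable M"
  shows "integrable M (\<lambda>x. f x * g x)"
proof (rule Bochner_Integration.integrable_bound)
  show "integrable M (\<lambda>x. (f x)\<^sup>2 + (g x)\<^sup>2)"
    using assms by (auto simp: square_integrable_def)
  show "(\<lambda>x. f x * g x) \<in> borel_measurable M"
    using assms by (auto simp: square_integrable_def)
  have "\<bar>a * b\<bar> \<le> a\<^sup>2 + b\<^sup>2" for a b :: real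
  proof -
    have "2 * \<bar>a * b\<bar> \<le> a\<^sup>2 + b\<^sup>2"
      using sum_squares_bound[of "\<bar>a\<bar>" "\<bar>b\<bar>"] by (simp add: abs_mult)
    then show ?thesis
      using abs_ge_zero[of "a * b"] by linarith
  qed
  then show "AE x in M. norm (f x * g x) \<le> norm ((f x)\<^sup>2 + (g x)\<^sup>2)"
    by simp
qed

lemma square_integrable_diff:
  assumes "f \<in> square_integrable M" "g \<in> square_integrable M"
  shows "(\<lambda>x. f x - g x) \<in> square_integrable M"
proof -
  have "integrable M (\<lambda>x. (f x)\<^sup>2 + (g x)\<^sup>2 - 2 * (f x * g x))"
    using assms integrable_mult_square_integrable[OF assms]
    by (auto simp: square_integrable_def)
  then show ?thesis
    using assms by (auto simp: square_integrable_def power2_diff mult.assoc)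
qed

lemma L2_I: "f \<in> square_integrable M \<Longrightarrow> ae_eq M `` {f} \<in> L2 M"
  by (simp add: L2_def quotientI)

lemma mem_ae_eq_class: "f \<in> square_integrable M \<Longrightarrow> f \<in> ae_eq M `` {f}"
  by (simp add: ae_eq_def)

lemma L2_nonempty: "A \<in> L2 M \<Longrightarrow> \<exists>f. f \<in> A"
  using in_quotient_imp_non_empty[OF equiv_ae_eq] by (auto simp: L2_def)

lemma L2_square_integrable: "A \<in> L2 M \<Longrightarrow> f \<in> A \<Longrightarrow> f \<in> square_integrable M"
  using in_quotient_imp_subset[OF equiv_ae_eq] by (auto simp: L2_def)

text \<open>Nondegeneracy of the pairing, which yields uniqueness: the test element is the class of
  the difference of two representatives.\<close>

lemma L2_eqI_inner:
  assumes A: "A \<in> L2 M" and B: "B \<in> L2 M"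
    and eq: "\<And>G. G \<in> L2 M \<Longrightarrow> L2_inner M A G = L2_inner M B G"
  shows "A = B"
proof -
  obtain a b where ab: "a \<in> A" "b \<in> B"
    using L2_nonempty A B by metis
  then have sq: "a \<in> square_integrable M" "b \<in> square_integrable M"
    using L2_square_integrable A B by auto
  define c where "c x = a x - b x" for x
  have c: "c \<in> square_integrable M"
    using square_integrable_diff[OF sq] by (simp add: c_def[abs_def])
  note int = integrable_mult_square_integrable[OF sq(1) c] integrable_mult_square_integrable[OF sq(2) c]
  have "(\<integral>x. a x * c x \<partial>M) = (\<integral>x. b x * c x \<partial>M)"
    using eq[OF L2_I[OF c]] L2_inner_eq[OF A L2_I[OF c] ab(1) mem_ae_eq_class[OF c]]
      L2_inner_eq[OF B L2_I[OF c] ab(2) mem_ae_eq_class[OF c]] by simp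
  \<comment> \<open>Both products with \<open>c\<close> are integrable, so the integrals may be
    subtracted; their difference is the integral of the square of \<open>c\<close>.\<close>
  then have "(\<integral>x. (c x)\<^sup>2 \<partial>M) = 0"
    using int by (simp add: c_def power2_eq_square left_diff_distrib)
  then have "AE x in M. (c x)\<^sup>2 = 0"
    using c by (subst (asm) integral_nonneg_eq_0_iff_AE) (auto simp: square_integrable_def)
  then have "(a, b) \<in> ae_eq M"
    using sq by (auto simp: ae_eq_def c_def)
  then show ?thesis
    using quotient_eqI[OF equiv_ae_eq] A B ab unfolding L2_def by blast
qed

text \<open>This is the existence half. \<open>density M f\<close> cuts negative values of
  \<open>f\<close> off at 0, so nonnegativity is what makes its integrals those of
  \<open>f x * g x\<close>.\<close>

lemma L2_inner_density:
  assumes f: "f \<in> square_integrable M" and nonneg: "\<And>x. 0 \<le> f x"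
    and G: "G \<in> L2 M" "g \<in> G"
  shows "integrable (density M f) g"
    and "(\<integral>x. g x \<partial>density M f) = L2_inner M (ae_eq M `` {f}) G"
proof -
  have g: "g \<in> square_integrable M"
    using L2_square_integrable G by auto
  have [measurable]: "f \<in> borel_measurable M" "g \<in> borel_measurable M"
    using f g by (auto simp: square_integrable_def)
  show "integrable (density M f) g"
    using integrable_mult_square_integrable[OF f g] nonneg by (subst integrable_density) auto
  show "(\<integral>x. g x \<partial>density M f) = L2_inner M (ae_eq M `` {f}) G"
    using nonneg
    by (simp add: integral_density L2_inner_eq[OF L2_I[OF f] G(1) mem_ae_eq_class[OF f] G(2)])
qed

theorem theorem3p1:
  fixes S :: "(real ^ 'd) set"
    and d :: "real ^ 'd \<Rightarrow> real ^ 'd \<Rightarrow> real"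
    and \<rho> p :: "(real ^ 'd) measure"
    and M :: "'w measure"
    and X :: "'w \<Rightarrow> real ^ 'd"
    and f :: "real ^ 'd \<Rightarrow> real"
  assumes "Metric_space S d"
    and "compact_space (Metric_space.mtopology S d)"
    and "Metric_space.mtopology S d = top_of_set S"
    and "\<rho> = restrict_space lborel S"
    and "sets p = sets (restrict_space borel S)"
    and "prob_space p"
    and "prob_space M"
    and "X \<in> M \<rightarrow>\<^sub>M restrict_space borel S"
    and "distr M (restrict_space borel S) X = p"
    and "absolutely_continuous_with_density (joint_cdf M X) f"
    and "f \<in> square_integrable \<rho>"
  shows "\<exists>!\<mu>. \<mu> \<in> L2 \<rho> \<and>
           (\<forall>G \<in> L2 \<rho>. \<forall>g \<in> G. integrable p g \<and> (\<integral>x. g x \<partial>p) = L2_inner \<rho> \<mu> G)"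
proof -
  \<comment> \<open>The topology of \<open>d\<close> is the Euclidean one on \<open>S\<close>, so
    \<open>S\<close> is compact in the usual sense, hence Borel.\<close>
  have "compact S"
    using assms(2,3) by (simp add: compactin_subspace flip: compactin_euclidean_iff)
  then have S: "S \<in> sets lborel"
    by (simp add: borel_compact)
  have X: "X \<in> borel_measurable M"
    using assms(8) by (simp add: measurable_restrict_space2_iff)
  have f: "f \<in> borel_measurable borel" and nonneg: "\<And>x. 0 \<le> f x"
    using assms(10) by (auto simp: absolutely_continuous_with_density_def)
  have p: "p = density \<rho> f"
    unfolding assms(4) assms(9)[symmetric]
    by (rule distr_restrict_space_eq_density)
      (use S assms(8) f distr_eq_density_of_joint_cdf[OF assms(7) X assms(10)] in auto)
  show ?thesis
  proof (rule ex1I[of _ "ae_eq \<rho> `` {f}"])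
    show "ae_eq \<rho> `` {f} \<in> L2 \<rho> \<and> (\<forall>G \<in> L2 \<rho>. \<forall>g \<in> G. integrable p g \<and>
        (\<integral>x. g x \<partial>p) = L2_inner \<rho> (ae_eq \<rho> `` {f}) G)"
      using L2_I[OF assms(11)] L2_inner_density[OF assms(11) nonneg] by (simp add: p)
    fix \<mu> assume \<mu>: "\<mu> \<in> L2 \<rho> \<and>
      (\<forall>G \<in> L2 \<rho>. \<forall>g \<in> G. integrable p g \<and> (\<integral>x. g x \<partial>p) = L2_inner \<rho> \<mu> G)"
    show "\<mu> = ae_eq \<rho> `` {f}"
    proof (rule L2_eqI_inner)
      \<comment> \<open>The property of \<open>\<mu>\<close> speaks of functions, so a
        representative of \<open>G\<close> is chosen; both inner products then equal its expectation
        under \<open>p\<close>.\<close>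
      fix G assume G: "G \<in> L2 \<rho>"
      then obtain g where "g \<in> G"
        using L2_nonempty by blast
      then show "L2_inner \<rho> \<mu> G = L2_inner \<rho> (ae_eq \<rho> `` {f}) G"
        using \<mu> G L2_inner_density(2)[OF assms(11) nonneg G] by (metis p)
    qed (use \<mu> L2_I[OF assms(11)] in auto)
  qed
qed

end
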